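(* Let $\varepsilon>0$ and let $\mathbf{w}_e$ be a submodular cardinality-based splitting function on a $k$-node hyperedge $e$. There exists a set of $O(\log_{1+\varepsilon}k)$ CB-gadgets, which can be constructed in $O(k\log_{1+\varepsilon}k)$ time, whose combined splitting function $\hat{\mathbf{w}}_e$ satisfies $\mathbf{w}_e(A)\le\hat{\mathbf{w}}_e(A)\le(1+\varepsilon)\mathbf{w}_e(A)$ for all $A\subseteq e$.
   Context: A splitting function on $e$ is $\mathbf{w}_e:2^e\to\mathbb{R}_{\ge0}$ that is symmetric ($\mathbf{w}_e(A)=\mathbf{w}_e(e\setminus A)$), satisfies $\mathbf{w}_e(\emptyset)=0$, is cardinality-based ($\mathbf{w}_e(A)$ depends only on $|A|$) and submodular. A CB-gadget for $e$ with parameters $a,b>0$ consists of two auxiliary nodes $e',e''$, a directed edge $v\to e'$ and a directed edge $e''\to v$ of weight $a$ for every $v\in e$, and a directed edge $e'\to e''$ of weight $ab$; its splitting function (minimum over placements of the auxiliary nodes of the total weight of edges leaving $A\cup\{\text{auxiliary nodes placed with }A\}$) is $A\mapsto a\min\{|A|,|e\setminus A|,b\}$. A combination of CB-gadgets with parameters $(a_j,b_j)_{j=1}^J$ has combined splitting function $\hat{\mathbf{w}}_e(A)=\sum_{j=1}^J a_j\min\{|A|,|e\setminus A|,b_j\}$. The splitting function values are assumed available in constant time each. *)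

theory Defs
  imports "HOL-Real_Asymp.Real_Asymp"
begin

definition submodular_on :: "'v set \<Rightarrow> ('v set \<Rightarrow> real) \<Rightarrow> bool" where
  "submodular_on e w \<longleftrightarrow>
     (\<forall>A B. A \<subseteq> e \<longrightarrow> B \<subseteq> e \<longrightarrow> w (A \<inter> B) + w (A \<union> B) \<le> w A + w B)"

definition cardinality_based_on :: "'v set \<Rightarrow> ('v set \<Rightarrow> real) \<Rightarrow> bool" where
  "cardinality_based_on e w \<longleftrightarrow>
     (\<forall>A B. A \<subseteq> e \<longrightarrow> B \<subseteq> e \<longrightarrow> card A = card B \<longrightarrow> w A = w B)"

definition submodular_cb_splitting :: "'v set \<Rightarrow> ('v set \<Rightarrow> real) \<Rightarrow> bool" where
  "submodular_cb_splitting e w \<longleftrightarrow>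
     (\<forall>A. A \<subseteq> e \<longrightarrow> 0 \<le> w A) \<and>
     (\<forall>A. A \<subseteq> e \<longrightarrow> w A = w (e - A)) \<and>
     w {} = 0 \<and>
     cardinality_based_on e w \<and>
     submodular_on e w"

text \<open>\<open>Entry j\<close> and \<open>Exit j\<close> are the auxiliary nodes $e'$ and $e''$ of the \<open>j\<close>-th gadget;
  different gadgets share only the nodes of the hyperedge.  A directed graph is given by its set
  of edges (source, target, weight).\<close>

datatype 'v node = Orig 'v | Entry nat | Exit nat

type_synonym 'v wedge = "'v node \<times> 'v node \<times> real"

definition cb_gadget :: "'v set \<Rightarrow> nat \<Rightarrow> real \<times> real \<Rightarrow> 'v wedge set" where
  "cb_gadget e j = (\<lambda>(a, b).
     (\<lambda>v. (Orig v, Entry j, a)) ` e \<union>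
     (\<lambda>v. (Exit j, Orig v, a)) ` e \<union>
     {(Entry j, Exit j, a * b)})"

definition cb_gadgets :: "'v set \<Rightarrow> (real \<times> real) list \<Rightarrow> 'v wedge set" where
  "cb_gadgets e gs = (\<Union>j<length gs. cb_gadget e j (gs ! j))"

definition aux_nodes :: "nat set \<Rightarrow> 'v node set" where
  "aux_nodes I = Entry ` I \<union> Exit ` I"

definition cut_weight :: "'v wedge set \<Rightarrow> 'v node set \<Rightarrow> real" where
  "cut_weight E S = (\<Sum>(u, v, c) \<in> {(u, v, c) \<in> E. u \<in> S \<and> v \<notin> S}. c)"

text \<open>\<open>T\<close> ranges over the sets of auxiliary nodes placed on the side of \<open>A\<close>.\<close>

definition graph_splitting :: "'v wedge set \<Rightarrow> 'v node set \<Rightarrow> 'v set \<Rightarrow> real" where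
  "graph_splitting E X A = Min ((\<lambda>T. cut_weight E (Orig ` A \<union> T)) ` Pow X)"

definition combined_splitting :: "'v set \<Rightarrow> (real \<times> real) list \<Rightarrow> 'v set \<Rightarrow> real" where
  "combined_splitting e gs = graph_splitting (cb_gadgets e gs) (aux_nodes {..<length gs})"

text \<open>
  The machine has a memory of natural numbers and a memory of reals, both addressed directly or
  indirectly through a cell of the former, and a write-only output to which it appends
  weighted edges between numbered nodes.  The only constants in a program are natural numbers, and
  there is no rounding from reals to natural numbers.  Every instruction and every
  evaluation of a test takes one time unit.
\<close>

datatype addr = Dir nat | Ind nat

datatype instr =
    NConst addr nat
  | NAdd addr addr addr
  | NSub addr addr addr
  | ROfNat addr addr
  | RAdd addr addr addr
  | RSub addr addr addr
  | RMul addr addr addr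
  | RDiv addr addr addr
  | RCopy addr addr
  | Query addr addr
  | Emit addr addr addr

datatype test = NLess addr addr | RLess addr addr

datatype prog =
    Instr instr
  | Seq prog prog
  | Cond test prog prog
  | While test prog

record ram_state =
  nmem :: "nat \<Rightarrow> nat"
  rmem :: "nat \<Rightarrow> real"
  outp :: "(nat \<times> nat \<times> real) list"

fun loc :: "ram_state \<Rightarrow> addr \<Rightarrow> nat" where
  "loc s (Dir i) = i"
| "loc s (Ind i) = nmem s i"

definition nval :: "ram_state \<Rightarrow> addr \<Rightarrow> nat" where
  "nval s x = nmem s (loc s x)"

definition rval :: "ram_state \<Rightarrow> addr \<Rightarrow> real" where
  "rval s x = rmem s (loc s x)"

definition nset :: "addr \<Rightarrow> nat \<Rightarrow> ram_state \<Rightarrow> ram_state" where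
  "nset x n s = s\<lparr>nmem := (nmem s)(loc s x := n)\<rparr>"

definition rset :: "addr \<Rightarrow> real \<Rightarrow> ram_state \<Rightarrow> ram_state" where
  "rset x r s = s\<lparr>rmem := (rmem s)(loc s x := r)\<rparr>"

fun exec_instr :: "(nat \<Rightarrow> real) \<Rightarrow> instr \<Rightarrow> ram_state \<Rightarrow> ram_state" where
  "exec_instr f (NConst x n) s = nset x n s"
| "exec_instr f (NAdd x y z) s = nset x (nval s y + nval s z) s"
| "exec_instr f (NSub x y z) s = nset x (nval s y - nval s z) s"
| "exec_instr f (ROfNat x y) s = rset x (real (nval s y)) s"
| "exec_instr f (RAdd x y z) s = rset x (rval s y + rval s z) s"
| "exec_instr f (RSub x y z) s = rset x (rval s y - rval s z) s"
| "exec_instr f (RMul x y z) s = rset x (rval s y * rval s z) s"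
| "exec_instr f (RDiv x y z) s = rset x (rval s y / rval s z) s"
| "exec_instr f (RCopy x y) s = rset x (rval s y) s"
| "exec_instr f (Query x y) s = rset x (f (nval s y)) s"
| "exec_instr f (Emit x y z) s = s\<lparr>outp := outp s @ [(nval s x, nval s y, rval s z)]\<rparr>"

fun holds :: "test \<Rightarrow> ram_state \<Rightarrow> bool" where
  "holds (NLess x y) s \<longleftrightarrow> nval s x < nval s y"
| "holds (RLess x y) s \<longleftrightarrow> rval s x < rval s y"

text \<open>\<open>exec f p s t s'\<close>: with oracle \<open>f\<close>, program \<open>p\<close> started in \<open>s\<close> halts after \<open>t\<close> time
  units in \<open>s'\<close>.\<close>

inductive exec :: "(nat \<Rightarrow> real) \<Rightarrow> prog \<Rightarrow> ram_state \<Rightarrow> nat \<Rightarrow> ram_state \<Rightarrow> bool"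
  for f :: "nat \<Rightarrow> real" where
  Instr: "exec f (Instr c) s 1 (exec_instr f c s)"
| Seq: "exec f p s t s' \<Longrightarrow> exec f q s' u s'' \<Longrightarrow> exec f (Seq p q) s (t + u) s''"
| CondT: "holds b s \<Longrightarrow> exec f p s t s' \<Longrightarrow> exec f (Cond b p q) s (1 + t) s'"
| CondF: "\<not> holds b s \<Longrightarrow> exec f q s t s' \<Longrightarrow> exec f (Cond b p q) s (1 + t) s'"
| WhileF: "\<not> holds b s \<Longrightarrow> exec f (While b p) s 1 s"
| WhileT: "holds b s \<Longrightarrow> exec f p s t s' \<Longrightarrow> exec f (While b p) s' u s'' \<Longrightarrow>
    exec f (While b p) s (1 + t + u) s''"

definition initial_state :: "nat \<Rightarrow> real \<Rightarrow> ram_state" where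
  "initial_state k \<epsilon> =
     \<lparr>nmem = (\<lambda>_. 0)(0 := k), rmem = (\<lambda>_. 0)(0 := \<epsilon>), outp = []\<rparr>"

text \<open>The hyperedge nodes are numbered from \<open>0\<close> in the order of \<open>vs\<close>; the auxiliary nodes
  follow, in pairs.\<close>

definition node_of :: "'v list \<Rightarrow> nat \<Rightarrow> 'v node" where
  "node_of vs i =
     (if i < length vs then Orig (vs ! i)
      else let d = i - length vs in if even d then Entry (d div 2) else Exit (d div 2))"

definition edges_of :: "'v list \<Rightarrow> ram_state \<Rightarrow> 'v wedge list" where
  "edges_of vs s = map (\<lambda>(x, y, c). (node_of vs x, node_of vs y, c)) (outp s)"

text \<open>The oracle \<open>f\<close> answers a query \<open>i\<close> with the value of \<open>w\<close> on the \<open>i\<close>-element subsets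
  of \<open>e\<close>; its answers to queries above \<open>card e\<close> are arbitrary.  The program has to list
  all edges of the gadgets, not only their parameters.\<close>

definition constructs_within ::
  "prog \<Rightarrow> real \<Rightarrow> 'v set \<Rightarrow> ('v set \<Rightarrow> real) \<Rightarrow> (real \<times> real) list \<Rightarrow> real \<Rightarrow> bool" where
  "constructs_within P \<epsilon> e w gs T \<longleftrightarrow>
     (\<forall>vs f. distinct vs \<longrightarrow> set vs = e \<longrightarrow> (\<forall>A. A \<subseteq> e \<longrightarrow> f (card A) = w A) \<longrightarrow>
       (\<exists>t s. exec f P (initial_state (card e) \<epsilon>) t s \<and> real t \<le> T \<and>
          distinct (edges_of vs s) \<and> set (edges_of vs s) = cb_gadgets e gs))"

lemma exec_deterministic:
  "exec f p s t s' \<Longrightarrow> exec f p s u s'' \<Longrightarrow> t = u \<and> s' = s''"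
proof (induction arbitrary: u s'' rule: exec.induct)
  case (Instr c s)
  then show ?case by (auto elim: exec.cases)
next
  case (Seq p s t s1 q u1 s2)
  from Seq.prems obtain t' u' m where
    "exec f p s t' m" "exec f q m u' s''" "u = t' + u'" by (auto elim: exec.cases)
  with Seq.IH show ?case by blast
next
  case (CondT b s p t s' q)
  from CondT.prems CondT.hyps obtain t' where "exec f p s t' s''" "u = 1 + t'"
    by (auto elim: exec.cases)
  with CondT.IH show ?case by blast
next
  case (CondF b s q t s' p)
  from CondF.prems CondF.hyps obtain t' where "exec f q s t' s''" "u = 1 + t'"
    by (auto elim: exec.cases)
  with CondF.IH show ?case by blast
next
  case (WhileF b s p)
  then show ?case by (auto elim: exec.cases)
next
  case (WhileT b s p t s1 u1 s2)
  from WhileT.prems WhileT.hyps obtain t' u' m where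
    "exec f p s t' m" "exec f (While b p) m u' s''" "u = 1 + t' + u'"
    by (auto elim: exec.cases)
  with WhileT.IH show ?case by blast
qed

lemma max_1_log_bigo:
  fixes \<epsilon> :: real
  assumes "\<epsilon> > 0"
  shows "(\<lambda>k::nat. max 1 (log (1 + \<epsilon>) (real k))) \<in> O(\<lambda>k. log (1 + \<epsilon>) (real k))"
proof -
  have "ln (1 + \<epsilon>) > 0" using assms by simp
  then show ?thesis unfolding log_def by real_asymp
qed

lemma finite_aux_nodes: "finite I \<Longrightarrow> finite (aux_nodes I)"
  by (simp add: aux_nodes_def)

lemma finite_cb_gadget: "finite e \<Longrightarrow> finite (cb_gadget e j g)"
  by (cases g) (simp add: cb_gadget_def)

lemma cut_weight_altdef:
  "finite E \<Longrightarrow>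
   cut_weight E S = (\<Sum>(u, v, c)\<in>E. if u \<in> S \<and> v \<notin> S then c else 0)"
  unfolding cut_weight_def
  by (rule sum.mono_neutral_cong_left) (auto split: if_splits)

lemma cut_weight_cb_gadget:
  assumes "finite e" "A \<subseteq> e"
    and S: "\<And>v. Orig v \<in> S \<longleftrightarrow> v \<in> A"
  shows "cut_weight (cb_gadget e j (a, b)) S =
    (if Entry j \<in> S then 0 else a * card A) +
    (if Exit j \<in> S then a * card (e - A) else 0) +
    (if Entry j \<in> S \<and> Exit j \<notin> S then a * b else 0)"
proof -
  let ?h = "\<lambda>(u, v, c). if u \<in> S \<and> v \<notin> S then c else (0::real)"
  let ?X = "(\<lambda>v. (Orig v, Entry j, a)) ` e" and ?Y = "(\<lambda>v. (Exit j, Orig v, a)) ` e"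
  let ?Z = "{(Entry j, Exit j, a * b)} :: ('a node \<times> 'a node \<times> real) set"
  have "cut_weight (cb_gadget e j (a, b)) S = sum ?h (?X \<union> ?Y \<union> ?Z)"
    using assms(1) by (simp add: cut_weight_altdef finite_cb_gadget) (simp add: cb_gadget_def)
  also have "\<dots> = sum ?h ?X + sum ?h ?Y + sum ?h ?Z"
    using assms(1) by (subst sum.union_disjoint; (subst sum.union_disjoint)?) auto
  also have "sum ?h ?X = (\<Sum>v\<in>e. if v \<in> A \<and> Entry j \<notin> S then a else 0)"
    by (subst sum.reindex) (auto simp: inj_on_def S intro!: sum.cong)
  also have "\<dots> = (if Entry j \<in> S then 0 else a * card A)"
    using assms(1,2) by (simp add: sum.If_cases Int_absorb1 flip: sum.inter_filter)
  also have "sum ?h ?Y = (\<Sum>v\<in>e. if v \<notin> A \<and> Exit j \<in> S then a else 0)"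
    by (subst sum.reindex) (auto simp: inj_on_def S intro!: sum.cong)
  also have "\<dots> = (if Exit j \<in> S then a * card (e - A) else 0)"
  proof -
    have "e \<inter> {v. v \<notin> A} = e - A" by blast
    then show ?thesis using assms(1) by (simp add: sum.If_cases)
  qed
  also have "sum ?h ?Z = (if Entry j \<in> S \<and> Exit j \<notin> S then a * b else 0)" by simp
  finally show ?thesis .
qed

lemma graph_splitting_cb_gadgets:
  fixes g :: "nat \<Rightarrow> real \<times> real"
  assumes "finite e" "A \<subseteq> e" "finite I"
    and pos: "\<And>j. j \<in> I \<Longrightarrow> fst (g j) > 0 \<and> snd (g j) > 0"
  shows "graph_splitting (\<Union>j\<in>I. cb_gadget e j (g j)) (aux_nodes I) A =
    (\<Sum>j\<in>I. fst (g j) * min (min (real (card A)) (real (card (e - A)))) (snd (g j)))"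
proof -
  let ?E = "\<Union>j\<in>I. cb_gadget e j (g j)"
  let ?m = "\<lambda>j. fst (g j) * min (min (real (card A)) (real (card (e - A)))) (snd (g j))"
  have cut: "cut_weight ?E S = (\<Sum>j\<in>I. cut_weight (cb_gadget e j (g j)) S)" for S
  proof -
    have "\<forall>i\<in>I. \<forall>j\<in>I. i \<noteq> j \<longrightarrow> cb_gadget e i (g i) \<inter> cb_gadget e j (g j) = {}"
      by (auto simp: cb_gadget_def split: prod.splits)
    then show ?thesis using assms(1,3)
      by (simp add: cut_weight_altdef finite_cb_gadget sum.UNION_disjoint)
  qed
  have single: "cut_weight (cb_gadget e j (g j)) (Orig ` A \<union> T) =
     (if Entry j \<in> T then 0 else fst (g j) * card A) +
     (if Exit j \<in> T then fst (g j) * card (e - A) else 0) +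
     (if Entry j \<in> T \<and> Exit j \<notin> T then fst (g j) * snd (g j) else 0)"
    if "T \<subseteq> aux_nodes I" for j T
  proof -
    have S: "Orig v \<in> Orig ` A \<union> T \<longleftrightarrow> v \<in> A" for v
      using that by (auto simp: aux_nodes_def)
    have "Entry j \<in> Orig ` A \<union> T \<longleftrightarrow> Entry j \<in> T" "Exit j \<in> Orig ` A \<union> T \<longleftrightarrow> Exit j \<in> T"
      by auto
    then show ?thesis
      using cut_weight_cb_gadget[OF assms(1,2) S, of j "fst (g j)" "snd (g j)"] by simp
  qed
  have lower: "(\<Sum>j\<in>I. ?m j) \<le> cut_weight ?E (Orig ` A \<union> T)" if "T \<subseteq> aux_nodes I" for T
    unfolding cut
  proof (rule sum_mono)
    fix j assume "j \<in> I"
    then have p: "fst (g j) > 0" "snd (g j) > 0" using pos by auto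
    let ?c = "min (min (real (card A)) (real (card (e - A)))) (snd (g j))"
    have "?c \<le> card A" "?c \<le> card (e - A)" "?c \<le> snd (g j)" by linarith+
    then have le: "?m j \<le> fst (g j) * card A" "?m j \<le> fst (g j) * card (e - A)"
      "?m j \<le> fst (g j) * snd (g j)" using p by (intro mult_left_mono; simp)+
    have nonneg: "0 \<le> fst (g j) * card A" "0 \<le> fst (g j) * card (e - A)" using p by simp_all
    have if_le: "x \<le> (if P then 0 else p) + (if Q then q else 0) + (if P \<and> \<not> Q then r else 0)"
      if "x \<le> p" "x \<le> q" "x \<le> r" "0 \<le> p" "0 \<le> q" for x p q r :: real and P Q
      using that by (cases P; cases Q) simp_all
    show "?m j \<le> cut_weight (cb_gadget e j (g j)) (Orig ` A \<union> T)"
      unfolding single[OF that] by (rule if_le) fact+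
  qed
  define In where "In = {j \<in> I. min (real (card (e - A))) (snd (g j)) < card A}"
  define Out where "Out = {j \<in> In. real (card (e - A)) < snd (g j)}"
  define T where "T = (Entry ` In \<union> Exit ` Out :: 'a node set)"
  have T: "T \<subseteq> aux_nodes I" by (auto simp: T_def In_def Out_def aux_nodes_def)
  have "cut_weight ?E (Orig ` A \<union> T) = (\<Sum>j\<in>I. ?m j)"
    unfolding cut
  proof (rule sum.cong[OF refl])
    fix j assume j: "j \<in> I"
    have in_T: "Entry j \<in> T \<longleftrightarrow> j \<in> In" "Exit j \<in> T \<longleftrightarrow> j \<in> Out"
      by (auto simp: T_def)
    consider "j \<notin> In" "j \<notin> Out" | "j \<in> In" "j \<in> Out" | "j \<in> In" "j \<notin> Out"
      unfolding Out_def by blast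
    then show "cut_weight (cb_gadget e j (g j)) (Orig ` A \<union> T) = ?m j"
    proof cases
      case 1
      then have "real (card A) \<le> real (card (e - A))" "real (card A) \<le> snd (g j)"
        using j unfolding In_def by simp_all
      then show ?thesis unfolding single[OF T] in_T using 1 by (simp add: min_absorb1)
    next
      case 2
      then have "real (card (e - A)) < real (card A)" "real (card (e - A)) < snd (g j)"
        unfolding In_def Out_def by simp_all
      then show ?thesis unfolding single[OF T] in_T using 2
        by (simp add: min_absorb1 min_absorb2)
    next
      case 3
      then have "snd (g j) \<le> real (card (e - A))" "snd (g j) < real (card A)"
        unfolding In_def Out_def by simp_all
      then show ?thesis unfolding single[OF T] in_T using 3 by (simp add: min_absorb2)
    qed
  qed
  then have attained:
    "(\<Sum>j\<in>I. ?m j) \<in> (\<lambda>T. cut_weight ?E (Orig ` A \<union> T)) ` Pow (aux_nodes I)"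
    using T by (intro image_eqI[where x = T]) simp_all
  show ?thesis unfolding graph_splitting_def
  proof (rule Min_eqI[OF _ _ attained])
    show "finite ((\<lambda>T. cut_weight ?E (Orig ` A \<union> T)) ` Pow (aux_nodes I))"
      using assms(3) by (simp add: finite_aux_nodes)
  next
    fix y assume "y \<in> (\<lambda>T. cut_weight ?E (Orig ` A \<union> T)) ` Pow (aux_nodes I)"
    then obtain T where "T \<subseteq> aux_nodes I" "y = cut_weight ?E (Orig ` A \<union> T)" by blast
    then show "(\<Sum>j\<in>I. ?m j) \<le> y" using lower by simp
  qed
qed

lemma graph_splitting_cb_gadget:
  assumes "finite e" "A \<subseteq> e" "a > 0" "b > 0"
  shows "graph_splitting (cb_gadget e j (a, b)) {Entry j, Exit j} A =
    a * min (min (real (card A)) (real (card (e - A)))) b"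
  using graph_splitting_cb_gadgets[OF assms(1,2), of "{j}" "\<lambda>_. (a, b)"] assms(3,4)
  by (simp add: aux_nodes_def insert_commute)

lemma combined_splitting_eq:
  assumes "finite e" "A \<subseteq> e" "\<forall>(a, b) \<in> set gs. a > 0 \<and> b > 0"
  shows "combined_splitting e gs A =
    (\<Sum>(a, b) \<leftarrow> gs. a * min (min (real (card A)) (real (card (e - A)))) b)"
proof -
  have "fst (gs ! j) > 0 \<and> snd (gs ! j) > 0" if "j < length gs" for j
    using assms(3) nth_mem[OF that] by (cases "gs ! j") fastforce
  then show ?thesis
    using graph_splitting_cb_gadgets[OF assms(1,2), of "{..<length gs}" "\<lambda>j. gs ! j"]
    by (simp add: combined_splitting_def cb_gadgets_def sum_list_sum_nth case_prod_beta
        atLeast0LessThan)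
qed

end

theory Submission
  imports Defs
begin

text \<open>On \<open>{0..k div 2}\<close> the splitting function is a nondecreasing concave function \<open>F\<close> of the
  cardinality.  Interpolate \<open>F\<close> linearly between breakpoints, chosen greedily so that consecutive
  breakpoints \<open>p < q\<close> satisfy \<open>q = p + 1\<close> or \<open>q \<le> (1 + \<epsilon>) p\<close>.  The interpolant is at most \<open>F\<close>,
  and since \<open>F q \<le> (q / p) F p\<close> it is at least \<open>F / (1 + \<epsilon>)\<close>; so \<open>1 + \<epsilon>\<close> times the interpolant
  is the required approximation, with one gadget per breakpoint where the slope drops.  Greediness
  makes the product of two consecutive breakpoints grow by a factor \<open>1 + \<epsilon>\<close> in every step,
  whence the logarithmic number of gadgets.  A single scan over the cardinalities finds the
  breakpoints, so the time is dominated by writing down the edges.\<close>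

section \<open>Approximating a concave sequence\<close>

lemma increment_sum_le:
  fixes F :: "nat \<Rightarrow> real"
  assumes "\<And>j. \<lbrakk>p \<le> j; j < p + m\<rbrakk> \<Longrightarrow> F (Suc j) - F j \<le> c"
  shows "F (p + m) - F p \<le> real m * c"
  using assms
proof (induction m)
  case (Suc m)
  have "F (p + m) - F p \<le> real m * c" using Suc by simp
  moreover have "F (Suc (p + m)) - F (p + m) \<le> c" using Suc.prems[of "p + m"] by simp
  ultimately show ?case by (simp add: algebra_simps)
qed simp

text \<open>The combined splitting function, read as a function of the size \<open>i\<close> of the
  smaller side of the cut.\<close>

definition gadget_sum :: "(real \<times> real) list \<Rightarrow> nat \<Rightarrow> real" where
  "gadget_sum gs i = (\<Sum>(a, b) \<leftarrow> gs. a * min (real i) b)"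

lemma gadget_sum_Nil [simp]: "gadget_sum [] i = 0"
  by (simp add: gadget_sum_def)

lemma gadget_sum_snoc [simp]:
  "gadget_sum (gs @ [(a, b)]) i = gadget_sum gs i + a * min (real i) b"
  by (simp add: gadget_sum_def)

lemma gadget_sum_const:
  assumes "\<forall>(a, b) \<in> set gs. b \<le> real p" "p \<le> i"
  shows "gadget_sum gs i = gadget_sum gs p"
  unfolding gadget_sum_def using assms
  by (intro arg_cong[where f = sum_list] map_cong) auto

text \<open>The profile of a splitting function by cardinality: concavity is what submodularity
  amounts to for such functions, see \<open>splitting_function_profile\<close>. Nothing is assumed
  about \<open>F\<close> above \<open>k\<close>.\<close>

locale concave_splitting =
  fixes F :: "nat \<Rightarrow> real" and k :: nat and \<epsilon> :: real
  assumes concave: "Suc (Suc i) \<le> k \<Longrightarrow> F (Suc (Suc i)) - F (Suc i) \<le> F (Suc i) - F i"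
    and symmetric: "i \<le> k \<Longrightarrow> F (k - i) = F i"
    and zero: "F 0 = 0"
    and nonneg: "i \<le> k \<Longrightarrow> 0 \<le> F i"
    and eps: "\<epsilon> > 0"
    and k_pos: "k \<ge> 1"
begin

section \<open>Chord slopes and monotonicity of the profile\<close>

lemma increment_antimono:
  assumes "i \<le> j" "j < k"
  shows "F (Suc j) - F j \<le> F (Suc i) - F i"
  using assms
proof (induction j rule: dec_induct)
  case (step n)
  then show ?case using concave[of n] by simp
qed simp

text \<open>Both chord slopes are compared with the increment of \<open>F\<close> at
  \<open>i\<close>. The cross-multiplied form avoids division and so admits \<open>p = i\<close> and
  \<open>i = q\<close>.\<close>

lemma three_points:
  assumes "p \<le> i" "i \<le> q" "q \<le> k"
  shows "(F q - F i) * (real i - real p) \<le> (F i - F p) * (real q - real i)"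
proof (cases "i = q")
  case False
  with assms have "i < q" by simp
  define c where "c = F (Suc i) - F i"
  have "F (i + (q - i)) - F i \<le> real (q - i) * c"
    unfolding c_def using assms by (intro increment_sum_le increment_antimono) auto
  then have up: "F q - F i \<le> (real q - real i) * c" using \<open>i < q\<close> by (simp add: of_nat_diff)
  \<comment> \<open>Negating \<open>F\<close> turns the upper bound of
    \<open>increment_sum_le\<close> into the lower bound needed to the left of
    \<open>i\<close>.\<close>
  have "- F (p + (i - p)) - - F p \<le> real (i - p) * - c"
  proof (rule increment_sum_le[where F = "\<lambda>i. - F i"])
    fix j assume "p \<le> j" "j < p + (i - p)"
    then show "- F (Suc j) - - F j \<le> - c"
      using increment_antimono[of j i] assms \<open>i < q\<close> unfolding c_def by simp
  qed
  then have low: "(real i - real p) * c \<le> F i - F p" using assms by (simp add: of_nat_diff)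
  have "(F q - F i) * (real i - real p) \<le> ((real q - real i) * c) * (real i - real p)"
    using up assms by (intro mult_right_mono) auto
  also have "\<dots> = ((real i - real p) * c) * (real q - real i)" by simp
  also have "\<dots> \<le> (F i - F p) * (real q - real i)"
    using low assms by (intro mult_right_mono) auto
  finally show ?thesis .
qed simp

text \<open>By symmetry \<open>F\<close> takes the same value at \<open>p\<close> and
  \<open>k - p\<close>, and a concave sequence does not go below that value at the point
  \<open>q\<close> between them.\<close>

lemma first_half_mono:
  assumes "p < q" "2 * q \<le> k + 1"
  shows "F p \<le> F q"
proof -
  have "p \<le> q" "q \<le> k - p" "k - p \<le> k" using assms by auto
  from three_points[OF this] have "(F (k - p) - F q) * (real q - real p) \<le> (F q - F p) * (real k - real p - real q)"
    using assms by (simp add: of_nat_diff)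
  then have "0 \<le> (F q - F p) * (real k - 2 * real p)"
    using symmetric[of p] assms by (simp add: algebra_simps)
  moreover have "real k - 2 * real p > 0" using assms by linarith
  ultimately show ?thesis by (simp add: zero_le_mult_iff)
qed

section \<open>Piecewise linear interpolation by gadgets\<close>

definition slope :: "nat \<Rightarrow> nat \<Rightarrow> real" where
  "slope p q = (F q - F p) / (real q - real p)"

text \<open>A gadget \<open>(a, b)\<close> lowers the slope of the sum by \<open>a\<close> at
  \<open>b\<close>, so a bend from \<open>s\<close> to \<open>t\<close>, scaled by
  \<open>1 + \<epsilon>\<close>, is one gadget. Without a drop nothing is added, because gadget
  weights must be positive.\<close>

definition add_gadget :: "nat \<Rightarrow> real \<Rightarrow> real \<Rightarrow> (real \<times> real) list \<Rightarrow> (real \<times> real) list" where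
  "add_gadget p s t gs = (if t < s then gs @ [((1 + \<epsilon>) * (s - t), real p)] else gs)"

text \<open>The last breakpoint is \<open>p\<close>, and \<open>s\<close> is the slope of the chord ending there.  The gadget at
  \<open>p\<close> has to wait for the next slope; until then it counts with the full slope \<open>s\<close>.
  At \<open>p = 0\<close> there is no chord yet, and \<open>s = 0\<close> keeps a gadget from being added there.\<close>

definition interpolates :: "nat \<Rightarrow> real \<Rightarrow> (real \<times> real) list \<Rightarrow> bool" where
  "interpolates p s gs \<longleftrightarrow>
     0 \<le> s \<and> (p = 0 \<longrightarrow> s = 0 \<and> gs = []) \<and> (p > 0 \<longrightarrow> F p - F (p - 1) \<le> s) \<and>
     (\<forall>(a, b) \<in> set gs. 0 < a \<and> 0 < b \<and> b \<le> real p) \<and>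
     gadget_sum gs p + (1 + \<epsilon>) * s * real p = (1 + \<epsilon>) * F p \<and>
     (\<forall>i\<le>p. F i \<le> gadget_sum gs i + (1 + \<epsilon>) * s * real i \<and>
            gadget_sum gs i + (1 + \<epsilon>) * s * real i \<le> (1 + \<epsilon>) * F i)"

text \<open>The two alternatives are those under which \<open>le_chord\<close> holds. The slack of
  one in \<open>2 * q \<le> k + 1\<close> admits the first pair \<open>(0, 1)\<close> even for
  \<open>k = 1\<close>.\<close>

definition admissible :: "nat \<Rightarrow> nat \<Rightarrow> bool" where
  "admissible p q \<longleftrightarrow> p < q \<and> 2 * q \<le> k + 1 \<and> (q = p + 1 \<or> real q \<le> (1 + \<epsilon>) * real p)"

lemma interpolates_0: "interpolates 0 0 []"
  by (simp add: interpolates_def zero)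

lemma slope_nonneg: "admissible p q \<Longrightarrow> 0 \<le> slope p q"
  using first_half_mono[of p q] by (simp add: slope_def admissible_def)

text \<open>The increment of \<open>F\<close> just before \<open>p\<close> separates the two slopes:
  it is at most \<open>s\<close> by the invariant, and by concavity at least the slope of the next
  chord. Hence the previous breakpoint need not be remembered.\<close>

lemma slope_le:
  assumes "interpolates p s gs" "admissible p q" "p > 0"
  shows "slope p q \<le> s"
proof -
  have pq: "p < q" "q \<le> k" using assms(2) k_pos by (auto simp: admissible_def)
  have "(F q - F p) * (real p - real (p - 1)) \<le> (F p - F (p - 1)) * (real q - real p)"
    using pq by (intro three_points) auto
  then have "F q - F p \<le> (F p - F (p - 1)) * (real q - real p)"
    using assms(3) by (simp add: of_nat_diff)
  then have "slope p q \<le> F p - F (p - 1)"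
    using pq by (simp add: slope_def divide_le_eq)
  then show ?thesis using assms(1,3) by (simp add: interpolates_def)
qed

lemma add_gadget_sum:
  assumes "p > 0 \<Longrightarrow> t \<le> s"
  shows "gadget_sum (add_gadget p s t gs) i =
    gadget_sum gs i + (1 + \<epsilon>) * (s - t) * min (real i) (real p)"
\<comment> \<open>If no gadget is added, either \<open>t = s\<close> or \<open>p = 0\<close>, and
  the extra term vanishes in both cases.\<close>
proof (cases "t < s \<or> p = 0")
  case False
  then have "t = s" using assms by auto
  then show ?thesis by (simp add: add_gadget_def)
qed (auto simp: add_gadget_def)

lemma chord_le:
  assumes "admissible p q" "p \<le> i" "i \<le> q"
  shows "F p + slope p q * (real i - real p) \<le> F i"
proof -
  have q: "p < q" "q \<le> k" using assms k_pos by (auto simp: admissible_def)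
  have "(F q - F p) * (real i - real p) \<le> (F i - F p) * (real q - real p)"
    using three_points[OF assms(2,3) q(2)] by (simp add: algebra_simps)
  then show ?thesis using q by (simp add: slope_def field_simps)
qed

text \<open>For \<open>q = p + 1\<close> the only point is \<open>q\<close>, where the chord is
  exact. Otherwise \<open>F i / i\<close> is at most \<open>F p / p\<close>, so \<open>F i\<close>
  exceeds \<open>F p\<close> by a factor of at most \<open>q / p\<close>, and the chord never falls
  below \<open>F p\<close>.\<close>

lemma le_chord:
  assumes adm: "admissible p q" and "p < i" "i \<le> q"
  shows "F i \<le> (1 + \<epsilon>) * (F p + slope p q * (real i - real p))"
proof (cases "q = p + 1")
  case True
  then have i: "i = q" using assms by simp
  have "q \<le> k" using adm k_pos by (auto simp: admissible_def)
  then have "0 \<le> F q" by (rule nonneg)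
  moreover have "F p + slope p q * (real i - real p) = F q"
    using True i by (simp add: slope_def)
  ultimately show ?thesis using i eps by (simp add: algebra_simps)
next
  case False
  then have q: "p < q" "q \<le> k" "real q \<le> (1 + \<epsilon>) * real p"
    using adm k_pos by (auto simp: admissible_def)
  \<comment> \<open>With \<open>p = 0\<close> the ratio condition would force
    \<open>q = 0\<close>.\<close>
  have p: "p > 0" using q by (cases p) auto
  have "(F i - F p) * (real p - real 0) \<le> (F p - F 0) * (real i - real p)"
    using assms q by (intro three_points) auto
  then have "F i * real p \<le> F p * real i" by (simp add: zero algebra_simps)
  also have "\<dots> \<le> F p * ((1 + \<epsilon>) * real p)"
    using q assms nonneg[of p] by (intro mult_left_mono) auto
  finally have "F i * real p \<le> ((1 + \<epsilon>) * F p) * real p" by (simp add: algebra_simps)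
  then have "F i \<le> (1 + \<epsilon>) * F p" using p by simp
  also have "\<dots> \<le> (1 + \<epsilon>) * (F p + slope p q * (real i - real p))"
    using slope_nonneg[OF adm] assms eps by (intro mult_left_mono) auto
  finally show ?thesis .
qed

text \<open>Up to \<open>p\<close> the new gadget is still linear and makes up exactly for replacing
  the slope \<open>s\<close> by that of the new chord, so nothing changes there. Beyond
  \<open>p\<close> all gadgets are saturated and the sum follows the scaled chord.\<close>

lemma interpolates_step:
  assumes I: "interpolates p s gs" and adm: "admissible p q"
  shows "interpolates q (slope p q) (add_gadget p s (slope p q) gs)"
proof -
  let ?t = "slope p q" and ?gs = "add_gadget p s (slope p q) gs"
  let ?H = "\<lambda>i. gadget_sum ?gs i + (1 + \<epsilon>) * ?t * real i"
  have q: "p < q" "q \<le> k" using adm k_pos by (auto simp: admissible_def)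
  have t: "0 \<le> ?t" by (rule slope_nonneg[OF adm])
  have sum: "gadget_sum ?gs i = gadget_sum gs i + (1 + \<epsilon>) * (s - ?t) * min (real i) (real p)" for i
    using slope_le[OF I adm] by (rule add_gadget_sum)
  have old: "?H i = gadget_sum gs i + (1 + \<epsilon>) * s * real i" if "i \<le> p" for i
    using that by (simp add: sum algebra_simps)
  have new: "?H i = (1 + \<epsilon>) * (F p + ?t * (real i - real p))" if "p \<le> i" for i
  proof -
    have "gadget_sum gs i = gadget_sum gs p"
      using I that by (intro gadget_sum_const) (auto simp: interpolates_def)
    moreover have "gadget_sum gs p = (1 + \<epsilon>) * F p - (1 + \<epsilon>) * s * real p"
      using I by (simp add: interpolates_def)
    ultimately show ?thesis using that by (simp add: sum algebra_simps)
  qed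
  have bounds: "F i \<le> ?H i \<and> ?H i \<le> (1 + \<epsilon>) * F i" if "i \<le> q" for i
  proof (cases "i \<le> p")
    case True
    then show ?thesis using I unfolding old[OF True] interpolates_def by blast
  next
    case False
    then have "F i \<le> (1 + \<epsilon>) * (F p + ?t * (real i - real p))"
      using le_chord[OF adm] that by simp
    moreover have "(1 + \<epsilon>) * (F p + ?t * (real i - real p)) \<le> (1 + \<epsilon>) * F i"
      using chord_le[OF adm, of i] False that eps by (intro mult_left_mono) auto
    ultimately show ?thesis using new[of i] False by simp
  qed
  \<comment> \<open>By concavity the last increment inside the chord is at most its slope; this
    renews the part of the invariant used by \<open>slope_le\<close>.\<close>
  have "(F q - F (q - 1)) * (real (q - 1) - real p) \<le> (F (q - 1) - F p) * (real q - real (q - 1))"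
    using q by (intro three_points) auto
  then have "(F q - F (q - 1)) * (real q - real p) \<le> F q - F p"
    using q by (simp add: of_nat_diff algebra_simps)
  then have last: "F q - F (q - 1) \<le> ?t" using q by (simp add: slope_def le_divide_eq)
  have at_q: "?H q = (1 + \<epsilon>) * F q" using new[of q] q by (simp add: slope_def)
  have "\<forall>(a, b) \<in> set ?gs. 0 < a \<and> 0 < b \<and> b \<le> real q"
    using I q t eps by (cases "p = 0") (auto simp: add_gadget_def interpolates_def split: if_splits)
  then show ?thesis using q t last at_q bounds unfolding interpolates_def by auto
qed

text \<open>Dropping to slope \<open>0\<close> at \<open>q\<close> turns the pending linear term
  into a last gadget, which is not yet saturated for \<open>i \<le> q\<close>.\<close>

lemma interpolates_final:
  assumes "interpolates q t gs" "i \<le> q"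
  shows "F i \<le> gadget_sum (add_gadget q t 0 gs) i"
    and "gadget_sum (add_gadget q t 0 gs) i \<le> (1 + \<epsilon>) * F i"
proof -
  have "gadget_sum (add_gadget q t 0 gs) i = gadget_sum gs i + (1 + \<epsilon>) * t * real i"
    using assms by (subst add_gadget_sum) (auto simp: interpolates_def)
  then show "F i \<le> gadget_sum (add_gadget q t 0 gs) i"
    and "gadget_sum (add_gadget q t 0 gs) i \<le> (1 + \<epsilon>) * F i"
    using assms by (simp_all add: interpolates_def)
qed

section \<open>The greedy choice of breakpoints and the number of gadgets\<close>

lemma length_add_gadget: "length gs \<le> length (add_gadget p s t gs)"
  "length (add_gadget p s t gs) \<le> length gs + 1"
  by (simp_all add: add_gadget_def)

text \<open>Here \<open>q\<close> is only a candidate for the breakpoint after \<open>p\<close>. The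
  product \<open>p * q\<close> is the potential that bounds the number of gadgets: single
  breakpoints may grow by less than a factor \<open>1 + \<epsilon>\<close> per step, but the product
  of neighbours does not.\<close>

definition scan_invariant :: "nat \<Rightarrow> nat \<Rightarrow> real \<Rightarrow> (real \<times> real) list \<Rightarrow> bool" where
  "scan_invariant p q s gs \<longleftrightarrow> interpolates p s gs \<and> admissible p q \<and>
     (p > 0 \<longrightarrow> (1 + \<epsilon>) ^ length gs \<le> real p * real q)"

lemma scan_invariant_init: "scan_invariant 0 1 0 []"
  using k_pos by (simp add: scan_invariant_def interpolates_0 admissible_def)

text \<open>The candidate \<open>q\<close> becomes a breakpoint only when \<open>q + 1\<close> would
  violate the ratio condition. That failure, multiplied by \<open>q\<close>, is the growth of the
  potential that pays for the new gadget.\<close>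

lemma scan_invariant_breakpoint:
  assumes inv: "scan_invariant p q s gs" and "2 * q + 1 < k" "(1 + \<epsilon>) * real p < real q + 1"
  shows "scan_invariant q (Suc q) (slope p q) (add_gadget p s (slope p q) gs)"
proof -
  let ?gs = "add_gadget p s (slope p q) gs"
  have I: "interpolates p s gs" and adm: "admissible p q"
    using inv by (auto simp: scan_invariant_def)
  have "(1 + \<epsilon>) ^ length ?gs \<le> real q * real (Suc q)"
  proof (cases "p = 0")
    case True
    \<comment> \<open>Leaving \<open>0\<close> adds no gadget, as the pending slope is
      \<open>0\<close> and the new one is nonnegative; so the potential only has to be at least
      \<open>1\<close>.\<close>
    then have "?gs = []" using I slope_nonneg[OF adm]
      by (auto simp: add_gadget_def interpolates_def)
    moreover have "1 * 1 \<le> real q * real (Suc q)"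
      using adm by (intro mult_mono) (auto simp: admissible_def)
    ultimately show ?thesis by simp
  next
    case False
    have "(1 + \<epsilon>) ^ length ?gs \<le> (1 + \<epsilon>) ^ (length gs + 1)"
      using eps by (intro power_increasing length_add_gadget) auto
    also have "\<dots> = (1 + \<epsilon>) * (1 + \<epsilon>) ^ length gs" by simp
    also have "\<dots> \<le> (1 + \<epsilon>) * (real p * real q)"
      using inv False eps by (intro mult_left_mono) (auto simp: scan_invariant_def)
    also have "\<dots> = real q * ((1 + \<epsilon>) * real p)" by simp
    also have "\<dots> \<le> real q * real (Suc q)"
      using assms(3) by (intro mult_left_mono) auto
    finally show ?thesis .
  qed
  then show ?thesis
    using interpolates_step[OF I adm] assms(2) by (auto simp: scan_invariant_def admissible_def)
qed

lemma scan_invariant_skip: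
  assumes "scan_invariant p q s gs" "2 * q + 1 < k" "real q + 1 \<le> (1 + \<epsilon>) * real p"
  shows "scan_invariant p (Suc q) s gs"
proof -
  have "real p * real q \<le> real p * real (Suc q)" by (intro mult_left_mono) auto
  then have "p > 0 \<longrightarrow> (1 + \<epsilon>) ^ length gs \<le> real p * real (Suc q)"
    using assms(1) unfolding scan_invariant_def by linarith
  then show ?thesis using assms by (simp add: scan_invariant_def admissible_def)
qed

text \<open>The factor \<open>2\<close> comes from bounding the potential by the square of
  \<open>k\<close> before taking logarithms.\<close>

lemma scan_invariant_length:
  assumes inv: "scan_invariant p q s gs"
  shows "real (length gs) \<le> 2 * max 1 (log (1 + \<epsilon>) (real k))"
proof (cases "p = 0")
  case True
  then show ?thesis using inv by (simp add: scan_invariant_def interpolates_def)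
next
  case False
  have pq: "p \<le> k" "q \<le> k"
    using inv k_pos by (auto simp: scan_invariant_def admissible_def)
  have "(1 + \<epsilon>) ^ length gs \<le> real p * real q"
    using inv False by (simp add: scan_invariant_def)
  also have "\<dots> \<le> real k * real k" using pq by (intro mult_mono) auto
  finally have "log (1 + \<epsilon>) ((1 + \<epsilon>) ^ length gs) \<le> log (1 + \<epsilon>) (real k * real k)"
    using eps k_pos by (subst log_le_cancel_iff) auto
  then have "real (length gs) \<le> 2 * log (1 + \<epsilon>) (real k)"
    using eps k_pos by (simp add: log_nat_power log_mult)
  then show ?thesis by simp
qed

end

section \<open>The program\<close>

text \<open>Copying a real cell to itself serves as the idle instruction; it accounts for the extra
  time unit of every block.\<close>

fun block :: "instr list \<Rightarrow> prog" where
  "block [] = Instr (RCopy (Dir 0) (Dir 0))"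
| "block (c # cs) = Seq (Instr c) (block cs)"

lemma exec_block: "exec f (block cs) s (Suc (length cs)) (fold (exec_instr f) cs s)"
proof (induction cs arbitrary: s)
  case Nil
  have "exec_instr f (RCopy (Dir 0) (Dir 0)) s = s" by (simp add: rset_def rval_def)
  then show ?case using exec.Instr[of f "RCopy (Dir 0) (Dir 0)" s] by simp
next
  case (Cons c cs)
  then show ?case using exec.Seq[OF exec.Instr Cons.IH] by simp
qed

text \<open>Total correctness with an upper bound on the time, so that branches of different cost
  can share one bound.\<close>

definition runs :: "(nat \<Rightarrow> real) \<Rightarrow> prog \<Rightarrow> ram_state \<Rightarrow> nat \<Rightarrow> (ram_state \<Rightarrow> bool) \<Rightarrow> bool" where
  "runs f p s T Q \<longleftrightarrow> (\<exists>t s'. exec f p s t s' \<and> t \<le> T \<and> Q s')"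

lemma runs_mono:
  assumes "runs f p s T Q" "T \<le> U" "\<And>s'. Q s' \<Longrightarrow> R s'"
  shows "runs f p s U R"
  using assms unfolding runs_def by (meson le_trans)

lemma runs_block:
  "Q (fold (exec_instr f) cs s) \<Longrightarrow> runs f (block cs) s (Suc (length cs)) Q"
  unfolding runs_def using exec_block by blast

lemma runs_Seq:
  assumes "runs f p s T R" "\<And>s'. R s' \<Longrightarrow> runs f q s' U Q"
  shows "runs f (Seq p q) s (T + U) Q"
proof -
  obtain t s' where 1: "exec f p s t s'" "t \<le> T" "R s'" using assms(1) by (auto simp: runs_def)
  then obtain u s'' where 2: "exec f q s' u s''" "u \<le> U" "Q s''"
    using assms(2)[OF 1(3)] unfolding runs_def by blast
  show ?thesis unfolding runs_def
    using exec.Seq[OF 1(1) 2(1)] 1 2 by (meson add_mono)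
qed

lemma runs_Cond:
  assumes "holds b s \<Longrightarrow> runs f p s T Q" "\<not> holds b s \<Longrightarrow> runs f q s T Q"
  shows "runs f (Cond b p q) s (Suc T) Q"
proof (cases "holds b s")
  case True
  then obtain t s' where "exec f p s t s'" "t \<le> T" "Q s'" using assms(1) by (auto simp: runs_def)
  then show ?thesis unfolding runs_def using exec.CondT[OF True, of f p t s' q] by force
next
  case False
  then obtain t s' where "exec f q s t s'" "t \<le> T" "Q s'" using assms(2) by (auto simp: runs_def)
  then show ?thesis unfolding runs_def using exec.CondF[OF False, of f q t s' p] by force
qed

lemma runs_WhileF: "\<not> holds b s \<Longrightarrow> Q s \<Longrightarrow> runs f (While b p) s 1 Q"
  unfolding runs_def using exec.WhileF by blast

lemma runs_WhileT:
  assumes "holds b s" "runs f p s T R" "\<And>s'. R s' \<Longrightarrow> runs f (While b p) s' U Q"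
  shows "runs f (While b p) s (Suc (T + U)) Q"
proof -
  obtain t s' where 1: "exec f p s t s'" "t \<le> T" "R s'" using assms(2) by (auto simp: runs_def)
  then obtain u s'' where 2: "exec f (While b p) s' u s''" "u \<le> U" "Q s''"
    using assms(3)[OF 1(3)] unfolding runs_def by blast
  have "1 + t + u \<le> Suc (T + U)" using 1 2 by simp
  then show ?thesis unfolding runs_def
    using exec.WhileT[OF assms(1) 1(1) 2(1)] 2(3) by blast
qed

text \<open>Register use.  Natural numbers: 0: \<open>k\<close>; 1: \<open>1\<close>; 2: \<open>q\<close>; 3: \<open>2q + 1\<close>; 4, 5: numbers of the
  entry and exit node of the next gadget; 6: hyperedge node; 7: \<open>0\<close>.
  Reals: 0: \<open>\<epsilon>\<close>; 1: \<open>1 + \<epsilon>\<close>; 2: \<open>p\<close>; 3: \<open>q\<close>; 4: \<open>F p\<close>; 5: old slope \<open>s\<close>; 6: \<open>F q\<close>; 7: new slope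
  \<open>t\<close>; 8: scratch; 9, 10: edge weights (9 also scratch); 11: \<open>1\<close>.\<close>

definition emit_spokes :: prog where
  "emit_spokes = While (NLess (Dir 6) (Dir 0))
     (block [Emit (Dir 6) (Dir 4) (Dir 9), Emit (Dir 5) (Dir 6) (Dir 9),
             NAdd (Dir 6) (Dir 6) (Dir 1)])"

definition emit_gadget :: prog where
  "emit_gadget = Cond (RLess (Dir 7) (Dir 5))
     (Seq (block [RSub (Dir 8) (Dir 5) (Dir 7), RMul (Dir 9) (Dir 1) (Dir 8),
                  RMul (Dir 10) (Dir 9) (Dir 2), NAdd (Dir 5) (Dir 4) (Dir 1), NConst (Dir 6) 0])
       (Seq emit_spokes
         (block [Emit (Dir 4) (Dir 5) (Dir 10), NAdd (Dir 4) (Dir 5) (Dir 1)])))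
     (block [])"

definition breakpoint :: prog where
  "breakpoint =
     Seq (block [Query (Dir 6) (Dir 2), RSub (Dir 7) (Dir 6) (Dir 4), RSub (Dir 8) (Dir 3) (Dir 2),
                 RDiv (Dir 7) (Dir 7) (Dir 8)])
       (Seq emit_gadget
         (block [RCopy (Dir 5) (Dir 7), RCopy (Dir 2) (Dir 3), RCopy (Dir 4) (Dir 6)]))"

definition scan_body :: prog where
  "scan_body =
     Seq (block [RMul (Dir 8) (Dir 1) (Dir 2), RAdd (Dir 9) (Dir 3) (Dir 11)])
       (Seq (Cond (RLess (Dir 8) (Dir 9)) breakpoint (block []))
         (block [NAdd (Dir 2) (Dir 2) (Dir 1), NAdd (Dir 3) (Dir 3) (Dir 1),
                 NAdd (Dir 3) (Dir 3) (Dir 1), RAdd (Dir 3) (Dir 3) (Dir 11)]))"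

text \<open>The loop runs while \<open>2 * q + 1 < k\<close>, so it stops at the middle without any
  division of natural numbers.\<close>

definition scan :: prog where
  "scan = While (NLess (Dir 3) (Dir 0)) scan_body"

text \<open>The start \<open>p = 0\<close>, \<open>F p = 0\<close>, \<open>s = 0\<close> is read off
  the zeroed memory. After the scan the candidate \<open>q\<close> becomes the last breakpoint, and
  clearing the new slope makes \<open>emit_gadget\<close> write the closing gadget at
  \<open>q\<close>.\<close>

definition gadget_program :: prog where
  "gadget_program =
     Seq (block [NConst (Dir 1) 1, NConst (Dir 2) 1, NConst (Dir 3) 3, NAdd (Dir 4) (Dir 0) (Dir 7),
                 ROfNat (Dir 11) (Dir 1), RAdd (Dir 1) (Dir 0) (Dir 11), RCopy (Dir 3) (Dir 11)])
       (Seq scan (Seq breakpoint (Seq (block [RSub (Dir 7) (Dir 7) (Dir 7)]) emit_gadget)))"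

definition spoke_output :: "nat \<Rightarrow> nat \<Rightarrow> real \<Rightarrow> nat list \<Rightarrow> (nat \<times> nat \<times> real) list" where
  "spoke_output x y a vs = concat (map (\<lambda>v. [(v, x, a), (y, v, a)]) vs)"

definition gadget_output :: "nat \<Rightarrow> nat \<Rightarrow> real \<times> real \<Rightarrow> (nat \<times> nat \<times> real) list" where
  "gadget_output k j = (\<lambda>(a, b).
     spoke_output (k + 2 * j) (k + 2 * j + 1) a [0..<k] @ [(k + 2 * j, k + 2 * j + 1, a * b)])"

definition gadgets_output :: "nat \<Rightarrow> (real \<times> real) list \<Rightarrow> (nat \<times> nat \<times> real) list" where
  "gadgets_output k gs = concat (map (\<lambda>j. gadget_output k j (gs ! j)) [0..<length gs])"

lemma gadgets_output_snoc:
  "gadgets_output k (gs @ [g]) = gadgets_output k gs @ gadget_output k (length gs) g"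
proof -
  have "map (\<lambda>j. gadget_output k j ((gs @ [g]) ! j)) [0..<length gs] =
        map (\<lambda>j. gadget_output k j (gs ! j)) [0..<length gs]"
    by (simp add: nth_append)
  then show ?thesis by (simp add: gadgets_output_def del: map_eq_conv)
qed

lemmas machine_simps = nset_def rset_def nval_def rval_def

text \<open>Each hyperedge node costs five units: the test, three instructions and the idle step of
  the block. The final failing test costs one more.\<close>

lemma runs_emit_spokes:
  assumes "nmem s 0 = k" "nmem s 1 = 1" "nmem s 6 \<le> k"
  shows "runs f emit_spokes s (5 * (k - nmem s 6) + 1)
    (\<lambda>s'. s' = s\<lparr>nmem := (nmem s)(6 := k),
       outp := outp s @ spoke_output (nmem s 4) (nmem s 5) (rmem s 9) [nmem s 6..<k]\<rparr>)"
  using assms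
proof (induction "k - nmem s 6" arbitrary: s)
  case 0
  then have "nmem s 6 = k" by simp
  then have "s = s\<lparr>nmem := (nmem s)(6 := k),
       outp := outp s @ spoke_output (nmem s 4) (nmem s 5) (rmem s 9) [nmem s 6..<k]\<rparr>"
    by (simp add: spoke_output_def fun_upd_idem)
  then show ?case unfolding emit_spokes_def
    using 0 by (intro runs_mono[OF runs_WhileF[where Q = "\<lambda>s'. s' = s"]])
      (auto simp: machine_simps)
next
  case (Suc n)
  let ?v = "nmem s 6"
  let ?s = "s\<lparr>nmem := (nmem s)(6 := Suc ?v), outp := outp s @ [(?v, nmem s 4, rmem s 9), (nmem s 5, ?v, rmem s 9)]\<rparr>"
  have v: "?v < k" using Suc.hyps(2) by simp
  have body: "runs f (block [Emit (Dir 6) (Dir 4) (Dir 9), Emit (Dir 5) (Dir 6) (Dir 9),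
             NAdd (Dir 6) (Dir 6) (Dir 1)]) s 4 (\<lambda>s'. s' = ?s)"
    using Suc.prems by (intro runs_mono[OF runs_block[where Q = "\<lambda>s'. s' = ?s"]])
      (auto simp: machine_simps)
  have "runs f emit_spokes ?s (5 * (k - nmem ?s 6) + 1)
    (\<lambda>s'. s' = ?s\<lparr>nmem := (nmem ?s)(6 := k),
       outp := outp ?s @ spoke_output (nmem ?s 4) (nmem ?s 5) (rmem ?s 9) [nmem ?s 6..<k]\<rparr>)"
    using Suc.prems Suc.hyps(2) v by (intro Suc.hyps(1)) auto
  moreover have "?s\<lparr>nmem := (nmem ?s)(6 := k),
       outp := outp ?s @ spoke_output (nmem ?s 4) (nmem ?s 5) (rmem ?s 9) [nmem ?s 6..<k]\<rparr> =
     s\<lparr>nmem := (nmem s)(6 := k),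
       outp := outp s @ spoke_output (nmem s 4) (nmem s 5) (rmem s 9) [nmem s 6..<k]\<rparr>"
    using v by (simp add: spoke_output_def upt_conv_Cons)
  ultimately have rest: "runs f emit_spokes ?s (5 * (k - Suc ?v) + 1)
    (\<lambda>s'. s' = s\<lparr>nmem := (nmem s)(6 := k),
       outp := outp s @ spoke_output (nmem s 4) (nmem s 5) (rmem s 9) [nmem s 6..<k]\<rparr>)"
    by simp
  show ?case
    unfolding emit_spokes_def
    by (rule runs_mono[OF runs_WhileT[OF _ body]])
      (use Suc.prems v rest in \<open>auto simp: machine_simps emit_spokes_def\<close>)
qed

section \<open>Correctness and running time of the program\<close>

context concave_splitting
begin

definition represents ::
  "nat \<Rightarrow> nat \<Rightarrow> real \<Rightarrow> real \<Rightarrow> real \<Rightarrow> real \<Rightarrow> (real \<times> real) list \<Rightarrow> ram_state \<Rightarrow> bool" where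
  "represents p q u s v t gs \<sigma> \<longleftrightarrow>
     nmem \<sigma> 0 = k \<and> nmem \<sigma> 1 = 1 \<and> nmem \<sigma> 2 = q \<and> nmem \<sigma> 3 = 2 * q + 1 \<and>
     nmem \<sigma> 4 = k + 2 * length gs \<and>
     rmem \<sigma> 1 = 1 + \<epsilon> \<and> rmem \<sigma> 2 = real p \<and> rmem \<sigma> 3 = real q \<and> rmem \<sigma> 4 = u \<and>
     rmem \<sigma> 5 = s \<and> rmem \<sigma> 6 = v \<and> rmem \<sigma> 7 = t \<and> rmem \<sigma> 11 = 1 \<and>
     outp \<sigma> = gadgets_output k gs"

text \<open>The length difference is \<open>0\<close> or \<open>1\<close>, so the cost of writing
  edges is charged to the gadget being added. That cost is \<open>5 * k + 11\<close>, which is at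
  most \<open>2 + 14 * k\<close> because \<open>k \<ge> 1\<close>.\<close>

lemma runs_emit_gadget:
  assumes rep: "represents p q u s v t gs \<sigma>"
  shows "runs f emit_gadget \<sigma> (2 + 14 * k * (length (add_gadget p s t gs) - length gs))
    (represents p q u s v t (add_gadget p s t gs))"
proof (cases "t < s")
  case True
  define a where "a = (1 + \<epsilon>) * (s - t)"
  let ?x = "k + 2 * length gs"
  define R where "R = (\<lambda>\<sigma>'. represents p q u s v t gs \<sigma>' \<and> nmem \<sigma>' 5 = ?x + 1 \<and> nmem \<sigma>' 6 = 0 \<and>
      rmem \<sigma>' 9 = a \<and> rmem \<sigma>' 10 = a * real p)"
  have 1: "runs f (block [RSub (Dir 8) (Dir 5) (Dir 7), RMul (Dir 9) (Dir 1) (Dir 8),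
      RMul (Dir 10) (Dir 9) (Dir 2), NAdd (Dir 5) (Dir 4) (Dir 1), NConst (Dir 6) 0]) \<sigma> 6 R"
    by (rule runs_mono[OF runs_block])
      (use rep in \<open>auto simp: R_def a_def represents_def machine_simps\<close>)
  define S where "S = (\<lambda>\<sigma>'. \<exists>\<sigma>\<^sub>0. R \<sigma>\<^sub>0 \<and> \<sigma>' = \<sigma>\<^sub>0\<lparr>nmem := (nmem \<sigma>\<^sub>0)(6 := k),
       outp := gadgets_output k gs @ spoke_output ?x (?x + 1) a [0..<k]\<rparr>)"
  have 2: "runs f emit_spokes \<sigma>' (5 * k + 1) S" if "R \<sigma>'" for \<sigma>'
    by (rule runs_mono[OF runs_emit_spokes[of \<sigma>' k]])
      (use that in \<open>auto simp: R_def S_def represents_def\<close>)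
  have 3: "runs f (block [Emit (Dir 4) (Dir 5) (Dir 10), NAdd (Dir 4) (Dir 5) (Dir 1)]) \<sigma>' 3
      (represents p q u s v t (gs @ [(a, real p)]))" if "S \<sigma>'" for \<sigma>'
    by (rule runs_mono[OF runs_block])
      (use that in \<open>auto simp: S_def R_def represents_def machine_simps gadgets_output_snoc
        gadget_output_def\<close>)
  have "runs f (Seq (block [RSub (Dir 8) (Dir 5) (Dir 7), RMul (Dir 9) (Dir 1) (Dir 8),
      RMul (Dir 10) (Dir 9) (Dir 2), NAdd (Dir 5) (Dir 4) (Dir 1), NConst (Dir 6) 0])
       (Seq emit_spokes
         (block [Emit (Dir 4) (Dir 5) (Dir 10), NAdd (Dir 4) (Dir 5) (Dir 1)])))
      \<sigma> (6 + ((5 * k + 1) + 3)) (represents p q u s v t (gs @ [(a, real p)]))"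
    by (intro runs_Seq[OF 1] runs_Seq[OF 2] 3)
  from this have "runs f emit_gadget \<sigma> (Suc (6 + ((5 * k + 1) + 3)))
      (represents p q u s v t (gs @ [(a, real p)]))"
    unfolding emit_gadget_def
    by (rule runs_Cond) (use rep True in \<open>simp add: represents_def machine_simps\<close>)
  then show ?thesis
    by (rule runs_mono) (use True k_pos in \<open>auto simp: add_gadget_def a_def\<close>)
next
  case False
  have "runs f (block []) \<sigma> 1 (represents p q u s v t gs)"
    by (rule runs_mono[OF runs_block]) (use rep in auto)
  then have "runs f emit_gadget \<sigma> (Suc 1) (represents p q u s v t gs)"
    unfolding emit_gadget_def
    by (intro runs_Cond) (use rep False in \<open>auto simp: represents_def machine_simps\<close>)
  then show ?thesis by (rule runs_mono) (use False in \<open>auto simp: add_gadget_def\<close>)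
qed

text \<open>Afterwards both ends of the interval are \<open>q\<close>; the caller either advances
  the candidate or stops scanning.\<close>

lemma runs_breakpoint:
  assumes rep: "represents p q (F p) s v t gs \<sigma>" and f: "f q = F q"
  defines "gs' \<equiv> add_gadget p s (slope p q) gs"
  shows "runs f breakpoint \<sigma> (11 + 14 * k * (length gs' - length gs))
    (represents q q (F q) (slope p q) (F q) (slope p q) gs')"
proof -
  have 1: "runs f (block [Query (Dir 6) (Dir 2), RSub (Dir 7) (Dir 6) (Dir 4),
      RSub (Dir 8) (Dir 3) (Dir 2), RDiv (Dir 7) (Dir 7) (Dir 8)]) \<sigma> 5
      (represents p q (F p) s (F q) (slope p q) gs)"
    by (rule runs_mono[OF runs_block])
      (use rep f in \<open>auto simp: represents_def machine_simps slope_def\<close>)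
  have 2: "runs f emit_gadget \<sigma>' (2 + 14 * k * (length gs' - length gs))
      (represents p q (F p) s (F q) (slope p q) gs')"
    if "represents p q (F p) s (F q) (slope p q) gs \<sigma>'" for \<sigma>'
    unfolding gs'_def by (rule runs_emit_gadget[OF that])
  have 3: "runs f (block [RCopy (Dir 5) (Dir 7), RCopy (Dir 2) (Dir 3), RCopy (Dir 4) (Dir 6)]) \<sigma>' 4
      (represents q q (F q) (slope p q) (F q) (slope p q) gs')"
    if "represents p q (F p) s (F q) (slope p q) gs' \<sigma>'" for \<sigma>'
    by (rule runs_mono[OF runs_block])
      (use that in \<open>auto simp: represents_def machine_simps\<close>)
  have "runs f breakpoint \<sigma> (5 + (2 + 14 * k * (length gs' - length gs) + 4))
    (represents q q (F q) (slope p q) (F q) (slope p q) gs')"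
    unfolding breakpoint_def by (intro runs_Seq[OF 1] runs_Seq[OF 2] 3)
  then show ?thesis by (rule runs_mono) auto
qed

text \<open>The cells for \<open>F q\<close> and the new slope hold leftovers of the previous
  breakpoint during the scan, hence the existential quantifiers.\<close>

definition scanning :: "nat \<Rightarrow> nat \<Rightarrow> real \<Rightarrow> (real \<times> real) list \<Rightarrow> ram_state \<Rightarrow> bool" where
  "scanning p q s gs \<sigma> \<longleftrightarrow> (\<exists>v t. represents p q (F p) s v t gs \<sigma>)"

lemma runs_scan_body:
  assumes sc: "scanning p q s gs \<sigma>" and f: "f q = F q"
  defines "jump \<equiv> (1 + \<epsilon>) * real p < real q + 1"
  defines "p' \<equiv> if jump then q else p" and "s' \<equiv> if jump then slope p q else s"
    and "gs' \<equiv> if jump then add_gadget p s (slope p q) gs else gs"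
  shows "runs f scan_body \<sigma> (20 + 14 * k * (length gs' - length gs)) (scanning p' (Suc q) s' gs')"
proof -
  obtain v t where rep: "represents p q (F p) s v t gs \<sigma>" using sc by (auto simp: scanning_def)
  define R where "R = (\<lambda>\<sigma>'. represents p q (F p) s v t gs \<sigma>' \<and>
    rmem \<sigma>' 8 = (1 + \<epsilon>) * real p \<and> rmem \<sigma>' 9 = real q + 1)"
  let ?T = "11 + 14 * k * (length gs' - length gs)"
  have 1: "runs f (block [RMul (Dir 8) (Dir 1) (Dir 2), RAdd (Dir 9) (Dir 3) (Dir 11)]) \<sigma> 3 R"
    by (rule runs_mono[OF runs_block])
      (use rep in \<open>auto simp: R_def represents_def machine_simps\<close>)
  have 2: "runs f (Cond (RLess (Dir 8) (Dir 9)) breakpoint (block [])) \<sigma>' (Suc ?T)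
      (scanning p' q s' gs')" if "R \<sigma>'" for \<sigma>'
  proof (rule runs_Cond)
    assume "holds (RLess (Dir 8) (Dir 9)) \<sigma>'"
    then have jump using that by (simp add: R_def jump_def machine_simps)
    moreover have "represents p q (F p) s v t gs \<sigma>'" using that by (simp add: R_def)
    ultimately show "runs f breakpoint \<sigma>' ?T (scanning p' q s' gs')"
      using f unfolding p'_def s'_def gs'_def
      by (intro runs_mono[OF runs_breakpoint]) (auto simp: scanning_def)
  next
    assume "\<not> holds (RLess (Dir 8) (Dir 9)) \<sigma>'"
    then have "\<not> jump" using that by (simp add: R_def jump_def machine_simps)
    then show "runs f (block []) \<sigma>' ?T (scanning p' q s' gs')"
      using that unfolding p'_def s'_def gs'_def
      by (intro runs_mono[OF runs_block[where Q = "scanning p' q s' gs'"]])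
        (auto simp: scanning_def R_def p'_def s'_def gs'_def)
  qed
  have 3: "runs f (block [NAdd (Dir 2) (Dir 2) (Dir 1), NAdd (Dir 3) (Dir 3) (Dir 1),
      NAdd (Dir 3) (Dir 3) (Dir 1), RAdd (Dir 3) (Dir 3) (Dir 11)]) \<sigma>' 5
      (scanning p' (Suc q) s' gs')" if "scanning p' q s' gs' \<sigma>'" for \<sigma>'
    by (rule runs_mono[OF runs_block])
      (use that in \<open>auto simp: scanning_def represents_def machine_simps\<close>)
  have "runs f scan_body \<sigma> (3 + (Suc ?T + 5)) (scanning p' (Suc q) s' gs')"
    unfolding scan_body_def by (intro runs_Seq[OF 1] runs_Seq[OF 2] 3)
  then show ?thesis by (rule runs_mono) auto
qed

text \<open>The oracle \<open>f\<close> is quantified inside, since the gadgets must not depend on its values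
  above \<open>k\<close>.\<close>

lemma runs_scan:
  assumes "scan_invariant p q s gs"
  shows "\<exists>p' q' s' gs'. scan_invariant p' q' s' gs' \<and> k \<le> 2 * q' + 1 \<and> length gs \<le> length gs' \<and>
    (\<forall>f \<sigma>. (\<forall>i\<le>k. f i = F i) \<longrightarrow> scanning p q s gs \<sigma> \<longrightarrow>
       runs f scan \<sigma> (1 + 21 * (k - q) + 14 * k * (length gs' - length gs)) (scanning p' q' s' gs'))"
  using assms
proof (induction "k - q" arbitrary: p q s gs rule: less_induct)
  case less
  show ?case
  proof (cases "2 * q + 1 < k")
    case False
    have "runs f scan \<sigma> (1 + 21 * (k - q) + 14 * k * (length gs - length gs)) (scanning p q s gs)"
      if "scanning p q s gs \<sigma>" for f \<sigma>
      unfolding scan_def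
      by (rule runs_mono[OF runs_WhileF])
        (use that False in \<open>auto simp: scanning_def represents_def machine_simps\<close>)
    then show ?thesis using less.prems False
      by (intro exI[of _ p] exI[of _ q] exI[of _ s] exI[of _ gs]) auto
  next
    case True
    define jump where "jump \<longleftrightarrow> (1 + \<epsilon>) * real p < real q + 1"
    define p1 where "p1 = (if jump then q else p)"
    define s1 where "s1 = (if jump then slope p q else s)"
    define gs1 where "gs1 = (if jump then add_gadget p s (slope p q) gs else gs)"
    have "scan_invariant p1 (Suc q) s1 gs1"
      using scan_invariant_breakpoint[OF less.prems True] scan_invariant_skip[OF less.prems True]
      by (auto simp: jump_def p1_def s1_def gs1_def)
    then obtain p' q' s' gs' where IH: "scan_invariant p' q' s' gs'" "k \<le> 2 * q' + 1"
      "length gs1 \<le> length gs'"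
      "\<And>f \<sigma>. \<lbrakk>\<forall>i\<le>k. f i = F i; scanning p1 (Suc q) s1 gs1 \<sigma>\<rbrakk> \<Longrightarrow>
         runs f scan \<sigma> (1 + 21 * (k - Suc q) + 14 * k * (length gs' - length gs1))
           (scanning p' q' s' gs')"
      using less.hyps[of "Suc q" p1 s1 gs1] True by (auto simp: diff_less_mono2)
    have len: "length gs \<le> length gs1" by (simp add: gs1_def length_add_gadget)
    have "runs f scan \<sigma> (1 + 21 * (k - q) + 14 * k * (length gs' - length gs))
        (scanning p' q' s' gs')"
      if f: "\<forall>i\<le>k. f i = F i" and sc: "scanning p q s gs \<sigma>" for f \<sigma>
    proof -
      have "f q = F q" using f True by simp
      with sc have body: "runs f scan_body \<sigma> (20 + 14 * k * (length gs1 - length gs))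
          (scanning p1 (Suc q) s1 gs1)"
        unfolding p1_def s1_def gs1_def jump_def by (rule runs_scan_body)
      have "holds (NLess (Dir 3) (Dir 0)) \<sigma>"
        using sc True by (auto simp: scanning_def represents_def machine_simps)
      from runs_WhileT[OF this body] have "runs f scan \<sigma>
          (Suc ((20 + 14 * k * (length gs1 - length gs)) +
            (1 + 21 * (k - Suc q) + 14 * k * (length gs' - length gs1)))) (scanning p' q' s' gs')"
        using IH(4)[OF f] unfolding scan_def .
      \<comment> \<open>The charges for gadgets telescope; truncated subtraction is exact since the
        list never shrinks.\<close>
      moreover have "14 * k * (length gs1 - length gs) + 14 * k * (length gs' - length gs1) =
          14 * k * (length gs' - length gs)"
        using len IH(3) by (simp flip: distrib_left)
      moreover have "21 + 21 * (k - Suc q) = 21 * (k - q)" using True by simp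
      ultimately show ?thesis by (elim runs_mono) auto
    qed
    then show ?thesis using IH(1-3) len
      by (intro exI[of _ p'] exI[of _ q'] exI[of _ s'] exI[of _ gs']) auto
  qed
qed

theorem gadget_program_correct:
  "\<exists>gs. (\<forall>(a, b) \<in> set gs. 0 < a \<and> 0 < b) \<and>
     real (length gs) \<le> 4 * max 1 (log (1 + \<epsilon>) (real k)) \<and>
     (\<forall>i. 2 * i \<le> k \<longrightarrow> F i \<le> gadget_sum gs i \<and> gadget_sum gs i \<le> (1 + \<epsilon>) * F i) \<and>
     (\<forall>f. (\<forall>i\<le>k. f i = F i) \<longrightarrow>
       runs f gadget_program (initial_state k \<epsilon>) (45 * k + 14 * k * length gs)
         (\<lambda>\<sigma>. outp \<sigma> = gadgets_output k gs))"
proof -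
  obtain p q s gs where inv: "scan_invariant p q s gs" "k \<le> 2 * q + 1" and
    run: "\<And>f \<sigma>. \<lbrakk>\<forall>i\<le>k. f i = F i; scanning 0 1 0 [] \<sigma>\<rbrakk> \<Longrightarrow>
      runs f scan \<sigma> (1 + 21 * (k - 1) + 14 * k * length gs) (scanning p q s gs)"
    using runs_scan[OF scan_invariant_init] by auto
  define t where "t = slope p q"
  define gs1 where "gs1 = add_gadget p s t gs"
  define gs2 where "gs2 = add_gadget q t 0 gs1"
  have I: "interpolates p s gs" and adm: "admissible p q"
    using inv by (auto simp: scan_invariant_def)
  have I1: "interpolates q t gs1"
    unfolding t_def gs1_def by (rule interpolates_step[OF I adm])
  have q: "0 < q" "q \<le> k" using adm k_pos by (auto simp: admissible_def)
  have pos: "\<forall>(a, b) \<in> set gs2. 0 < a \<and> 0 < b"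
    using I1 q eps by (auto simp: gs2_def add_gadget_def interpolates_def)
  have len: "length gs \<le> length gs1" "length gs1 \<le> length gs2"
    "length gs1 \<le> length gs + 1" "length gs2 \<le> length gs1 + 1"
    unfolding gs1_def gs2_def by (rule length_add_gadget)+
  \<comment> \<open>At most two gadgets follow the scan, at \<open>p\<close> and at
    \<open>q\<close>; they fit into \<open>4\<close> because the maximum is at least
    \<open>1\<close>.\<close>
  have count: "real (length gs2) \<le> 4 * max 1 (log (1 + \<epsilon>) (real k))"
    using scan_invariant_length[OF inv(1)] len by linarith
  \<comment> \<open>Since \<open>k \<le> 2 * q + 1\<close>, every \<open>i\<close> with
    \<open>2 * i \<le> k\<close> satisfies \<open>i \<le> q\<close>.\<close>
  have approx: "F i \<le> gadget_sum gs2 i" "gadget_sum gs2 i \<le> (1 + \<epsilon>) * F i" if "2 * i \<le> k" for i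
    using interpolates_final[OF I1, of i] that inv(2) by (simp_all add: gs2_def)
  have prog: "runs f gadget_program (initial_state k \<epsilon>) (45 * k + 14 * k * length gs2)
      (\<lambda>\<sigma>. outp \<sigma> = gadgets_output k gs2)" if f: "\<forall>i\<le>k. f i = F i" for f
  proof -
    have fq: "f q = F q" using f q by simp
    have init: "runs f (block [NConst (Dir 1) 1, NConst (Dir 2) 1, NConst (Dir 3) 3,
        NAdd (Dir 4) (Dir 0) (Dir 7), ROfNat (Dir 11) (Dir 1), RAdd (Dir 1) (Dir 0) (Dir 11),
        RCopy (Dir 3) (Dir 11)]) (initial_state k \<epsilon>) 8 (scanning 0 1 0 [])"
      by (rule runs_mono[OF runs_block])
        (auto simp: scanning_def represents_def machine_simps initial_state_def zero
          gadgets_output_def)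
    have bp: "runs f breakpoint \<sigma> (11 + 14 * k * (length gs1 - length gs))
        (represents q q (F q) t (F q) t gs1)" if "scanning p q s gs \<sigma>" for \<sigma>
      using that fq runs_breakpoint unfolding t_def gs1_def scanning_def by blast
    have reset: "runs f (block [RSub (Dir 7) (Dir 7) (Dir 7)]) \<sigma> 2
        (represents q q (F q) t (F q) 0 gs1)"
      if "represents q q (F q) t (F q) t gs1 \<sigma>" for \<sigma>
      by (rule runs_mono[OF runs_block])
        (use that in \<open>auto simp: represents_def machine_simps\<close>)
    have last: "runs f emit_gadget \<sigma> (2 + 14 * k * (length gs2 - length gs1))
        (\<lambda>\<sigma>. outp \<sigma> = gadgets_output k gs2)"
      if "represents q q (F q) t (F q) 0 gs1 \<sigma>" for \<sigma>
      by (rule runs_mono[OF runs_emit_gadget[OF that]])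
        (auto simp: gs2_def represents_def)
    have "runs f gadget_program (initial_state k \<epsilon>)
       (8 + ((1 + 21 * (k - 1) + 14 * k * length gs) + ((11 + 14 * k * (length gs1 - length gs)) +
         (2 + (2 + 14 * k * (length gs2 - length gs1))))))
       (\<lambda>\<sigma>. outp \<sigma> = gadgets_output k gs2)"
      unfolding gadget_program_def
      by (intro runs_Seq[OF init] runs_Seq[OF run[OF f]] runs_Seq[OF bp] runs_Seq[OF reset] last)
    moreover have "14 * k * length gs + 14 * k * (length gs1 - length gs) +
        14 * k * (length gs2 - length gs1) = 14 * k * length gs2"
      using len by (simp flip: distrib_left)
    moreover have "24 + 21 * (k - 1) \<le> 45 * k" using k_pos by simp
    ultimately show ?thesis by (elim runs_mono) auto
  qed
  show ?thesis using pos count approx prog by blast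
qed

end

section \<open>The output as a set of gadgets\<close>

text \<open>Needed to carry distinctness from the numbered output over to the edges.\<close>

lemma inj_node_of:
  assumes "distinct vs"
  shows "inj (node_of vs)"
proof (rule injI)
  fix x y assume eq: "node_of vs x = node_of vs y"
  show "x = y"
  proof (cases "x < length vs")
    case True
    then show ?thesis using eq assms
      by (cases "y < length vs") (auto simp: node_of_def Let_def nth_eq_iff_index_eq split: if_splits)
  next
    case False
    then have "\<not> y < length vs" using eq by (auto simp: node_of_def Let_def split: if_splits)
    with False eq have "even (x - length vs) = even (y - length vs)"
      "(x - length vs) div 2 = (y - length vs) div 2"
      by (auto simp: node_of_def Let_def split: if_splits)
    \<comment> \<open>Parity and half determine the offset of an auxiliary node.\<close>
    then have "x - length vs = y - length vs" by presburger
    then show ?thesis using False \<open>\<not> y < length vs\<close> by simp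
  qed
qed

lemma set_spoke_output:
  "set (spoke_output x y a vs) = (\<lambda>v. (v, x, a)) ` set vs \<union> (\<lambda>v. (y, v, a)) ` set vs"
  by (auto simp: spoke_output_def)

lemma distinct_spoke_output:
  assumes "distinct vs" "x \<notin> set vs" "y \<notin> set vs"
  shows "distinct (spoke_output x y a vs)"
  using assms
proof (induction vs)
  case (Cons v vs)
  then show ?case using set_spoke_output[of x y a vs] by (auto simp: spoke_output_def)
qed (simp add: spoke_output_def)

lemma distinct_gadget_output: "distinct (gadget_output k j g)"
  by (cases g) (auto simp: gadget_output_def set_spoke_output intro!: distinct_spoke_output)

text \<open>Auxiliary nodes have larger numbers than hyperedge nodes, so the larger endpoint of an
  edge reveals its gadget. This keeps the outputs of different gadgets disjoint.\<close>

lemma gadget_output_nodes: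
  assumes "(x, y, c) \<in> set (gadget_output k j g)"
  shows "max x y \<in> {k + 2 * j, k + 2 * j + 1}"
  using assms by (cases g) (auto simp: gadget_output_def set_spoke_output max_def)

lemma set_gadgets_output:
  "set (gadgets_output k gs) = (\<Union>j<length gs. set (gadget_output k j (gs ! j)))"
  by (auto simp: gadgets_output_def)

lemma distinct_gadgets_output: "distinct (gadgets_output k gs)"
proof (induction gs rule: rev_induct)
  case (snoc g gs)
  have "set (gadgets_output k gs) \<inter> set (gadget_output k (length gs) g) = {}"
  proof -
    have False if "j < length gs" "(x, y, c) \<in> set (gadget_output k j (gs ! j))"
      "(x, y, c) \<in> set (gadget_output k (length gs) g)" for j x y c
      using gadget_output_nodes[OF that(2)] gadget_output_nodes[OF that(3)] that(1)
      unfolding insert_iff empty_iff by linarith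
    then show ?thesis by (fastforce simp: set_gadgets_output)
  qed
  then show ?case using snoc by (simp add: gadgets_output_snoc distinct_gadget_output)
qed (simp add: gadgets_output_def)

lemma image_gadget_output:
  assumes "set vs = e" "length vs = k"
  shows "(\<lambda>(x, y, c). (node_of vs x, node_of vs y, c)) ` set (gadget_output k j g) =
    cb_gadget e j g"
proof -
  obtain a b where g: "g = (a, b)" by (cases g)
  have aux: "node_of vs (k + 2 * j) = Entry j" "node_of vs (Suc (k + 2 * j)) = Exit j"
    using assms(2) by (simp_all add: node_of_def)
  have "node_of vs ` {0..<k} = Orig ` ((!) vs ` {0..<k})"
    using assms(2) by (force simp: node_of_def image_image)
  also have "(!) vs ` {0..<k} = e" using assms by (auto simp: set_conv_nth)
  finally have e: "Orig ` e = node_of vs ` {0..<k}" by simp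
  have "cb_gadget e j g = (\<lambda>u. (u, Entry j, a)) ` Orig ` e \<union> (\<lambda>u. (Exit j, u, a)) ` Orig ` e \<union>
      {(Entry j, Exit j, a * b)}"
    by (simp add: cb_gadget_def g image_image)
  then show ?thesis
    unfolding e by (simp add: g gadget_output_def set_spoke_output image_Un image_image aux)
qed

lemma edges_of_gadgets_output:
  assumes "distinct vs" "set vs = e" "outp \<sigma> = gadgets_output (card e) gs"
  shows "distinct (edges_of vs \<sigma>)" "set (edges_of vs \<sigma>) = cb_gadgets e gs"
proof -
  have len: "length vs = card e" using assms distinct_card by metis
  have "inj (\<lambda>(x, y, c). (node_of vs x, node_of vs y, c))"
    using inj_node_of[OF assms(1)] by (auto simp: inj_def)
  then have "inj_on (\<lambda>(x, y, c). (node_of vs x, node_of vs y, c)) (set (outp \<sigma>))"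
    using inj_on_subset by blast
  then show "distinct (edges_of vs \<sigma>)"
    unfolding edges_of_def distinct_map using assms(3) distinct_gadgets_output by simp
  show "set (edges_of vs \<sigma>) = cb_gadgets e gs"
    using image_gadget_output[OF assms(2) len]
    by (simp add: edges_of_def assms(3) set_gadgets_output image_UN cb_gadgets_def)
qed

section \<open>Cardinality-based splitting functions\<close>

lemma splitting_function_profile:
  assumes "finite e" "card e \<ge> 1" "submodular_cb_splitting e w" "\<epsilon> > 0"
  obtains F where "\<And>A. A \<subseteq> e \<Longrightarrow> w A = F (card A)" "concave_splitting F (card e) \<epsilon>"
proof -
  \<comment> \<open>The choice is immaterial for \<open>i \<le> card e\<close>, because
    \<open>w\<close> depends only on the cardinality.\<close>
  define F where "F i = w (SOME A. A \<subseteq> e \<and> card A = i)" for i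
  have w: "w A = F (card A)" if "A \<subseteq> e" for A
  proof -
    have "(SOME B. B \<subseteq> e \<and> card B = card A) \<subseteq> e \<and> card (SOME B. B \<subseteq> e \<and> card B = card A) = card A"
      by (rule someI[of "\<lambda>B. B \<subseteq> e \<and> card B = card A" A]) (use that in simp)
    then show ?thesis using that assms(3)
      unfolding F_def submodular_cb_splitting_def cardinality_based_on_def by metis
  qed
  have split: "\<And>A. A \<subseteq> e \<Longrightarrow> w A = w (e - A)" "\<And>A. A \<subseteq> e \<Longrightarrow> 0 \<le> w A" "w {} = 0"
    using assms(3) unfolding submodular_cb_splitting_def by blast+
  have subset: "\<exists>A. A \<subseteq> e \<and> card A = i" if "i \<le> card e" for i
    using that obtain_subset_with_card_n[of i e] by blast
  have "concave_splitting F (card e) \<epsilon>"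
  proof
    fix i assume i: "Suc (Suc i) \<le> card e"
    then obtain A where A: "A \<subseteq> e" "card A = Suc (Suc i)" using subset by blast
    \<comment> \<open>Submodularity for \<open>insert x B\<close> and \<open>insert y B\<close>, two
      sets of size \<open>Suc i\<close> that differ in one element each, is concavity at
      \<open>i\<close>.\<close>
    then obtain x y B where B: "A = insert x (insert y B)" "x \<notin> insert y B" "y \<notin> B"
      by (auto simp: card_Suc_eq)
    have fin: "finite B" using A B assms(1) finite_subset by auto
    have "card B = i" using A B fin by simp
    then have "w B = F i" "w (insert x B) = F (Suc i)" "w (insert y B) = F (Suc i)"
      "w A = F (Suc (Suc i))" using A B fin by (auto simp: w)
    moreover have "insert x B \<subseteq> e" "insert y B \<subseteq> e" using A(1) B(1) by auto
    then have "w (insert x B \<inter> insert y B) + w (insert x B \<union> insert y B)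
        \<le> w (insert x B) + w (insert y B)"
      using assms(3) unfolding submodular_cb_splitting_def submodular_on_def by blast
    moreover have "insert x B \<inter> insert y B = B" "insert x B \<union> insert y B = A" using B by auto
    ultimately show "F (Suc (Suc i)) - F (Suc i) \<le> F (Suc i) - F i" by simp
  next
    fix i assume "i \<le> card e"
    then obtain A where A: "A \<subseteq> e" "card A = i" using subset by blast
    then have "card (e - A) = card e - i" using assms(1) by (simp add: card_Diff_subset finite_subset)
    then show "F (card e - i) = F i"
      using A w[of A] w[of "e - A"] split(1)[of A] by simp
    show "0 \<le> F i" using A w[of A] split(2)[of A] by simp
  next
    show "F 0 = 0" using w[of "{}"] split(3) by simp
  qed (use assms in auto)
  with w show thesis by (rule that)
qed

theorem theorem8:
  "\<exists>(P :: prog) (C :: real).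
     \<forall>(\<epsilon> :: real) (k :: nat) (e :: 'v set) (w :: 'v set \<Rightarrow> real).
       \<epsilon> > 0 \<longrightarrow> finite e \<longrightarrow> card e = k \<longrightarrow> k \<ge> 1 \<longrightarrow> submodular_cb_splitting e w \<longrightarrow>
       (\<exists>gs :: (real \<times> real) list.
          (\<forall>(a, b) \<in> set gs. a > 0 \<and> b > 0) \<and>
          real (length gs) \<le> C * max 1 (log (1 + \<epsilon>) (real k)) \<and>
          constructs_within P \<epsilon> e w gs (C * (real k * max 1 (log (1 + \<epsilon>) (real k)))) \<and>
          (\<forall>A. A \<subseteq> e \<longrightarrow>
             w A \<le> combined_splitting e gs A \<and>
             combined_splitting e gs A \<le> (1 + \<epsilon>) * w A))"
proof (intro exI[of _ gadget_program] exI[of _ "101 :: real"] allI impI)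
  fix \<epsilon> :: real and k :: nat and e :: "'v set" and w :: "'v set \<Rightarrow> real"
  assume eps: "\<epsilon> > 0" and fin: "finite e" and k: "card e = k" and k1: "k \<ge> 1"
    and w: "submodular_cb_splitting e w"
  define M where "M = max 1 (log (1 + \<epsilon>) (real k))"
  obtain F where F: "\<And>A. A \<subseteq> e \<Longrightarrow> w A = F (card A)" and conc: "concave_splitting F k \<epsilon>"
    using splitting_function_profile[OF fin _ w eps] k k1 by auto
  interpret concave_splitting F k \<epsilon> by (rule conc)
  obtain gs where pos: "\<forall>(a, b) \<in> set gs. 0 < a \<and> 0 < b"
    and len: "real (length gs) \<le> 4 * M"
    and approx: "\<And>i. 2 * i \<le> k \<Longrightarrow> F i \<le> gadget_sum gs i \<and> gadget_sum gs i \<le> (1 + \<epsilon>) * F i"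
    and run: "\<And>f. \<forall>i\<le>k. f i = F i \<Longrightarrow>
       runs f gadget_program (initial_state k \<epsilon>) (45 * k + 14 * k * length gs)
         (\<lambda>\<sigma>. outp \<sigma> = gadgets_output k gs)"
    using gadget_program_correct unfolding M_def by auto
  \<comment> \<open>The constant is \<open>101 = 45 + 14 * 4\<close>; the linear term is absorbed
    because \<open>M \<ge> 1\<close>.\<close>
  have "real (45 * k + 14 * k * length gs) = 45 * real k * 1 + 14 * real k * real (length gs)"
    by simp
  also have "\<dots> \<le> 45 * real k * M + 14 * real k * (4 * M)"
    using len by (intro add_mono mult_left_mono) (auto simp: M_def)
  also have "\<dots> = 101 * (real k * M)" by simp
  finally have time: "real (45 * k + 14 * k * length gs) \<le> 101 * (real k * M)" .
  have "constructs_within gadget_program \<epsilon> e w gs (101 * (real k * M))"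
    unfolding constructs_within_def
  proof (intro allI impI)
    fix vs :: "'v list" and f
    assume vs: "distinct vs" "set vs = e" and f: "\<forall>A. A \<subseteq> e \<longrightarrow> f (card A) = w A"
    have "f i = F i" if "i \<le> k" for i
      using that k f F obtain_subset_with_card_n[of i e] by metis
    then obtain t \<sigma> where "exec f gadget_program (initial_state k \<epsilon>) t \<sigma>"
      "t \<le> 45 * k + 14 * k * length gs" and out: "outp \<sigma> = gadgets_output k gs"
      using run unfolding runs_def by blast
    moreover from this have "real t \<le> 101 * (real k * M)" using time by linarith
    ultimately show "\<exists>t s. exec f gadget_program (initial_state (card e) \<epsilon>) t s \<and>
        real t \<le> 101 * (real k * M) \<and> distinct (edges_of vs s) \<and>
        set (edges_of vs s) = cb_gadgets e gs"
      using edges_of_gadgets_output[OF vs, of \<sigma> gs] unfolding k by blast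
  qed
  moreover have "w A \<le> combined_splitting e gs A \<and> combined_splitting e gs A \<le> (1 + \<epsilon>) * w A"
    if A: "A \<subseteq> e" for A
  proof -
    \<comment> \<open>Both functions depend only on the smaller side, whose size is at most
      \<open>k / 2\<close>, where the approximation is available.\<close>
    define i where "i = min (card A) (card (e - A))"
    have cards: "card A + card (e - A) = k"
      using A fin k by (metis card_Un_disjoint Diff_disjoint Diff_partition finite_Diff finite_subset)
    have "w A = w (e - A)" using w A unfolding submodular_cb_splitting_def by blast
    then have "w A = F i" using F[OF A] F[of "e - A"] by (simp add: i_def min_def)
    moreover have "combined_splitting e gs A = gadget_sum gs i"
      using combined_splitting_eq[OF fin A pos] by (simp add: gadget_sum_def i_def of_nat_min)
    moreover have "2 * i \<le> k" using cards by (simp add: i_def)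
    ultimately show ?thesis using approx[of i] by simp
  qed
  moreover have "real (length gs) \<le> 101 * M" using len by (simp add: M_def)
  ultimately show "\<exists>gs :: (real \<times> real) list.
          (\<forall>(a, b) \<in> set gs. a > 0 \<and> b > 0) \<and>
          real (length gs) \<le> 101 * max 1 (log (1 + \<epsilon>) (real k)) \<and>
          constructs_within gadget_program \<epsilon> e w gs (101 * (real k * max 1 (log (1 + \<epsilon>) (real k)))) \<and>
          (\<forall>A. A \<subseteq> e \<longrightarrow>
             w A \<le> combined_splitting e gs A \<and>
             combined_splitting e gs A \<le> (1 + \<epsilon>) * w A)"
    using pos unfolding M_def by blast
qed

end
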